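(* Fix $\alpha,\nu\in\mathbb N^h$ and $\beta,\eta\in\mathbb Z^h$. Suppose that $N\alpha+\beta$ and $N\nu+\eta$ are weak compositions of the same total degree (sum of entries) for all sufficiently large $N$. Then $$N\longmapsto[\mathbf x^{N\nu+\eta}]\,\kappa_{N\alpha+\beta}(\mathbf x)$$ is eventually polynomial; that is, there is a polynomial $P$ with which this function agrees for all sufficiently large $N$.
   Context: $\mathbb N=\{0,1,2,\dots\}$; $\mathbf x=(x_1,\dots,x_h)$; $\mathbf x^a=x_1^{a_1}\cdots x_h^{a_h}$; $[\mathbf x^a]f$ is the coefficient of $\mathbf x^a$ in $f$. A weak composition is a finite sequence of nonnegative integers. The isobaric divided difference (Demazure operator) is $\pi_i(f)=\dfrac{x_if-x_{i+1}s_i(f)}{x_i-x_{i+1}}$, where $s_i$ exchanges $x_i$ and $x_{i+1}$. The key polynomial $\kappa_\alpha$ of a weak composition $\alpha$ is defined by $\kappa_\alpha=\mathbf x^\alpha$ if $\alpha$ is weakly decreasing, and $\kappa_\alpha=\pi_i\,\kappa_{s_i\alpha}$ if $\alpha_i<\alpha_{i+1}$, where $s_i\alpha$ is $\alpha$ with its parts $i$ and $i+1$ exchanged (this is well defined). *)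

theory Defs
  imports
    "HOL-Library.Poly_Mapping"
    "HOL-Computational_Algebra.Polynomial"
    "HOL-Combinatorics.Transposition"
begin

text \<open>
  Polynomials over the integers, as finitely supported maps from exponent vectors to
  coefficients. The variables are indexed from 0, so \<open>xvar i\<close> is
  $x_{i+1}$ in 1-based numbering; likewise the parts of a composition \<open>\<alpha>\<close> are \<open>\<alpha> ! 0, \<alpha> ! 1, \<dots>\<close>.
\<close>

type_synonym mpol = "(nat \<Rightarrow>\<^sub>0 nat) \<Rightarrow>\<^sub>0 int"

definition xvar :: "nat \<Rightarrow> mpol" where
  "xvar i = Poly_Mapping.single (Poly_Mapping.single i 1) 1"

definition xmonom :: "nat list \<Rightarrow> mpol" where
  "xmonom a = Poly_Mapping.single (Poly_Mapping.nth a) 1"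

definition xcoeff :: "nat list \<Rightarrow> mpol \<Rightarrow> int" where
  "xcoeff a f = Poly_Mapping.lookup f (Poly_Mapping.nth a)"

text \<open>
  The inner \<open>map_key\<close> exchanges two entries of an exponent vector; the outer one
  applies this to all exponent vectors of \<open>f\<close>. See \<open>swap_vars_single\<close>,
  \<open>swap_vars_mult\<close> and \<open>swap_vars_xvar\<close> below.
\<close>

definition swap_vars :: "nat \<Rightarrow> mpol \<Rightarrow> mpol" where
  "swap_vars i f =
     Poly_Mapping.map_key (Poly_Mapping.map_key (Transposition.transpose i (Suc i))) f"

text \<open>The quotient defining $\pi_i(f)$; it exists and is unique by \<open>demazure_eq_iff\<close>.\<close>

definition demazure :: "nat \<Rightarrow> mpol \<Rightarrow> mpol" where
  "demazure i f = (THE g. (xvar i - xvar (Suc i)) * g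
                        = xvar i * f - xvar (Suc i) * swap_vars i f)"

definition swap_parts :: "nat \<Rightarrow> nat list \<Rightarrow> nat list" where
  "swap_parts i \<alpha> = \<alpha>[i := \<alpha> ! Suc i, Suc i := \<alpha> ! i]"

inductive is_key_poly :: "nat list \<Rightarrow> mpol \<Rightarrow> bool" where
  decreasing: "sorted_wrt (\<ge>) \<alpha> \<Longrightarrow> is_key_poly \<alpha> (xmonom \<alpha>)"
| ascent: "Suc i < length \<alpha> \<Longrightarrow> \<alpha> ! i < \<alpha> ! Suc i \<Longrightarrow> is_key_poly (swap_parts i \<alpha>) f
    \<Longrightarrow> is_key_poly \<alpha> (demazure i f)"

text \<open>
  Independence of the chosen ascents is \<open>ex1_is_key_poly\<close>, so \<open>key_poly\<close> satisfies
  the defining equations of key polynomials, \<open>key_poly_decreasing\<close> and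
  \<open>key_poly_ascent\<close>.
\<close>

definition key_poly :: "nat list \<Rightarrow> mpol" where
  "key_poly \<alpha> = (THE f. is_key_poly \<alpha> f)"

text \<open>The vector $N\alpha+\beta$.\<close>

definition dilate :: "nat \<Rightarrow> nat list \<Rightarrow> int list \<Rightarrow> int list" where
  "dilate N \<alpha> \<beta> = map2 (\<lambda>a b. int N * int a + b) \<alpha> \<beta>"

subsection \<open>The exchange of two variables\<close>

abbreviation tr :: "nat \<Rightarrow> nat \<Rightarrow> nat" where
  "tr i \<equiv> Transposition.transpose i (Suc i)"

lemma inj_tr: "inj (tr i)"
  by (rule injI) (metis transpose_involutory)

lemma lookup_map_tr:
  "Poly_Mapping.lookup (Poly_Mapping.map_key (tr i) a) k = Poly_Mapping.lookup a (tr i k)"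
  by (simp add: map_key.rep_eq inj_tr)

lemma map_tr_invol [simp]: "Poly_Mapping.map_key (tr i) (Poly_Mapping.map_key (tr i) a) = a"
  by (rule poly_mapping_eqI) (simp add: lookup_map_tr)

lemma inj_map_tr: "inj (Poly_Mapping.map_key (tr i) :: (nat \<Rightarrow>\<^sub>0 nat) \<Rightarrow> _)"
  by (rule injI) (metis map_tr_invol)

lemma lookup_swap_vars:
  "Poly_Mapping.lookup (swap_vars i f) a
     = Poly_Mapping.lookup f (Poly_Mapping.map_key (tr i) a)"
  by (simp add: swap_vars_def map_key.rep_eq inj_map_tr)

lemma swap_vars_single:
  "swap_vars i (Poly_Mapping.single a c) = Poly_Mapping.single (Poly_Mapping.map_key (tr i) a) c"
  by (rule poly_mapping_eqI) (auto simp: lookup_swap_vars lookup_single when_def)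

lemma swap_vars_invol [simp]: "swap_vars i (swap_vars i f) = f"
  by (rule poly_mapping_eqI) (simp add: lookup_swap_vars)

lemma swap_vars_0 [simp]: "swap_vars i 0 = 0"
  by (rule poly_mapping_eqI) (simp add: lookup_swap_vars)

lemma swap_vars_diff: "swap_vars i (f - g) = swap_vars i f - swap_vars i g"
  by (rule poly_mapping_eqI) (simp add: lookup_swap_vars lookup_minus)

lemma mpol_induct [case_names zero single diff]:
  assumes "P 0" "\<And>a. P (Poly_Mapping.single a 1)" "\<And>f g. P f \<Longrightarrow> P g \<Longrightarrow> P (f - g)"
  shows "P (f :: mpol)"
  by (rule frag_induction[where S = UNIV]) (use assms in auto)

lemma swap_vars_mult: "swap_vars i (f * g) = swap_vars i f * swap_vars i g"
proof (induction f rule: mpol_induct)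
  case (single a)
  show ?case
  proof (induction g rule: mpol_induct)
    case (single b)
    show ?case
      by (simp add: mult_single swap_vars_single map_key_plus inj_tr)
  qed (simp_all add: right_diff_distrib swap_vars_diff)
qed (simp_all add: left_diff_distrib swap_vars_diff)

lemma swap_vars_xvar: "swap_vars i (xvar j) = xvar (tr i j)"
proof -
  have "Poly_Mapping.map_key (tr i) (Poly_Mapping.single j (1::nat))
          = Poly_Mapping.single (tr i j) 1"
    by (rule poly_mapping_eqI) (auto simp: lookup_map_tr lookup_single when_def)
  then show ?thesis
    by (simp add: xvar_def swap_vars_single)
qed

subsection \<open>The Demazure operators\<close>

lemma xvar_power: "xvar i ^ p = Poly_Mapping.single (Poly_Mapping.single i p) 1"
  by (induction p) (simp_all add: xvar_def mult_single flip: single_add)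

lemma xvar_eq_iff: "xvar i = xvar j \<longleftrightarrow> i = j"
  by (metis xvar_def lookup_single_eq lookup_single_not_eq zero_neq_one)

lemma dvd_diff_swap_vars: "xvar i - xvar (Suc i) dvd f - swap_vars i f"
proof (induction f rule: mpol_induct)
  case (single a)
  let ?X = "xvar i" and ?Y = "xvar (Suc i)"
  define p q where "p = Poly_Mapping.lookup a i" and "q = Poly_Mapping.lookup a (Suc i)"
  define b where "b = Poly_Mapping.update i 0 (Poly_Mapping.update (Suc i) 0 a)"
  let ?B = "Poly_Mapping.single b 1 :: mpol"
  have a: "a = b + (Poly_Mapping.single i p + Poly_Mapping.single (Suc i) q)"
    by (rule poly_mapping_eqI)
      (auto simp: b_def p_def q_def lookup_add lookup_update lookup_single when_def)
  have sb: "Poly_Mapping.map_key (tr i) b = b"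
    by (rule poly_mapping_eqI)
      (auto simp: b_def lookup_map_tr lookup_update Transposition.transpose_def)
  have "Poly_Mapping.single a 1 = ?B * (?X ^ p * ?Y ^ q)"
    by (simp add: a xvar_power mult_single)
  moreover have "swap_vars i (?X ^ n) = ?Y ^ n \<and> swap_vars i (?Y ^ n) = ?X ^ n" for n
    by (induction n)
      (simp_all add: swap_vars_mult swap_vars_xvar xvar_power[of _ 0] swap_vars_single
        map_key_zero inj_tr flip: single_one)
  ultimately have "Poly_Mapping.single a 1 - swap_vars i (Poly_Mapping.single a 1)
      = ?B * (?X ^ p * ?Y ^ q - ?Y ^ p * ?X ^ q)"
    by (simp add: swap_vars_mult swap_vars_single sb right_diff_distrib)
  also have "?X ^ p * ?Y ^ q - ?Y ^ p * ?X ^ q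
      = ?X ^ q * (?X ^ p - ?Y ^ p) - ?X ^ p * (?X ^ q - ?Y ^ q)"
    by (simp add: algebra_simps)
  finally have eq: "Poly_Mapping.single a 1 - swap_vars i (Poly_Mapping.single a 1)
      = ?B * (?X ^ q * (?X ^ p - ?Y ^ p) - ?X ^ p * (?X ^ q - ?Y ^ q))" .
  have "?X - ?Y dvd ?X ^ n - ?Y ^ n" for n
    by (metis dvd_triv_left power_diff_sumr2)
  then show ?case
    unfolding eq by (simp only: dvd_mult dvd_diff)
next
  case (diff f g)
  then have "xvar i - xvar (Suc i) dvd (f - swap_vars i f) - (g - swap_vars i g)"
    by (rule dvd_diff)
  then show ?case
    by (simp add: swap_vars_diff algebra_simps)
qed simp

lemma demazure_eq_iff:
  "demazure i f = g \<longleftrightarrow>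
     (xvar i - xvar (Suc i)) * g = xvar i * f - xvar (Suc i) * swap_vars i f"
proof -
  let ?X = "xvar i" and ?Y = "xvar (Suc i)"
  have nz: "?X - ?Y \<noteq> 0"
    by (simp add: xvar_eq_iff)
  obtain r where r: "f - swap_vars i f = (?X - ?Y) * r"
    using dvd_diff_swap_vars by (metis dvdE)
  have "?X * f - ?Y * swap_vars i f = (?X - ?Y) * f + ?Y * (f - swap_vars i f)"
    by (simp add: algebra_simps)
  then have ex: "(?X - ?Y) * (f + ?Y * r) = ?X * f - ?Y * swap_vars i f"
    by (simp add: r algebra_simps)
  have "demazure i f = f + ?Y * r"
    unfolding demazure_def
  proof (rule the_equality)
    show "(?X - ?Y) * (f + ?Y * r) = ?X * f - ?Y * swap_vars i f"
      by (rule ex)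
  next
    fix g assume "(?X - ?Y) * g = ?X * f - ?Y * swap_vars i f"
    then show "g = f + ?Y * r"
      using ex nz by (metis mult_left_cancel)
  qed
  then show ?thesis
    using ex nz by (metis mult_left_cancel)
qed

lemma demazure_mult:
  "(xvar i - xvar (Suc i)) * demazure i f = xvar i * f - xvar (Suc i) * swap_vars i f"
  using demazure_eq_iff by blast

lemma map_tr_commute:
  assumes "Suc i < j"
  shows "Poly_Mapping.map_key (tr i) (Poly_Mapping.map_key (tr j) a)
       = Poly_Mapping.map_key (tr j) (Poly_Mapping.map_key (tr i) a)"
  using assms
  by (intro poly_mapping_eqI) (auto simp: lookup_map_tr Transposition.transpose_def)

lemma swap_vars_commute:
  assumes "Suc i < j"
  shows "swap_vars i (swap_vars j f) = swap_vars j (swap_vars i f)"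
  by (intro poly_mapping_eqI) (simp add: lookup_swap_vars map_tr_commute[OF assms])

lemma swap_vars_braid:
  "swap_vars i (swap_vars (Suc i) (swap_vars i f))
     = swap_vars (Suc i) (swap_vars i (swap_vars (Suc i) f))"
proof -
  have "Poly_Mapping.map_key (tr i) (Poly_Mapping.map_key (tr (Suc i))
          (Poly_Mapping.map_key (tr i) a))
      = Poly_Mapping.map_key (tr (Suc i)) (Poly_Mapping.map_key (tr i)
          (Poly_Mapping.map_key (tr (Suc i)) a))" for a :: "nat \<Rightarrow>\<^sub>0 nat"
    by (intro poly_mapping_eqI) (auto simp: lookup_map_tr Transposition.transpose_def)
  then show ?thesis
    by (intro poly_mapping_eqI) (simp add: lookup_swap_vars)
qed

lemma demazure_commute:
  assumes "Suc i < j"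
  shows "demazure i (demazure j f) = demazure j (demazure i f)"
proof -
  define x y u v where "x = xvar i" and "y = xvar (Suc i)" and "u = xvar j" and "v = xvar (Suc j)"
  note defs = x_def y_def u_def v_def
  have [simp]: "swap_vars j x = x" "swap_vars j y = y" "swap_vars i u = u" "swap_vars i v = v"
    using assms by (auto simp: defs swap_vars_xvar Transposition.transpose_def)
  have I: "(x - y) * demazure i g = x * g - y * swap_vars i g" for g
    unfolding defs by (rule demazure_mult)
  have J: "(u - v) * demazure j g = u * g - v * swap_vars j g" for g
    unfolding defs by (rule demazure_mult)
  have SJ: "(u - v) * swap_vars i (demazure j f)
      = u * swap_vars i f - v * swap_vars i (swap_vars j f)"
    using arg_cong[OF J[of f], of "swap_vars i"] by (simp add: swap_vars_mult swap_vars_diff)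
  have SI: "(x - y) * swap_vars j (demazure i f)
      = x * swap_vars j f - y * swap_vars i (swap_vars j f)"
    using arg_cong[OF I[of f], of "swap_vars j"]
    by (simp add: swap_vars_mult swap_vars_diff swap_vars_commute[OF assms])
  have "(u - v) * ((x - y) * demazure i (demazure j f))
      = x * ((u - v) * demazure j f) - y * ((u - v) * swap_vars i (demazure j f))"
    unfolding I by (simp only: algebra_simps)
  also have "\<dots> = u * ((x - y) * demazure i f) - v * ((x - y) * swap_vars j (demazure i f))"
    unfolding I J SI SJ by (simp only: algebra_simps)
  also have "\<dots> = (x - y) * ((u - v) * demazure j (demazure i f))"
    unfolding J by (simp only: algebra_simps)
  finally have "((u - v) * (x - y)) * demazure i (demazure j f)
      = ((u - v) * (x - y)) * demazure j (demazure i f)"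
    by (simp only: ac_simps)
  moreover have "(u - v) * (x - y) \<noteq> 0"
    by (simp add: defs xvar_eq_iff)
  ultimately show ?thesis
    by simp
qed

lemma demazure_braid:
  "demazure i (demazure (Suc i) (demazure i f))
     = demazure (Suc i) (demazure i (demazure (Suc i) f))"
proof -
  define x y z where "x = xvar i" and "y = xvar (Suc i)" and "z = xvar (Suc (Suc i))"
  note defs = x_def y_def z_def
  define s t where "s = swap_vars i" and "t = swap_vars (Suc i)"
  define A B where "A = demazure i" and "B = demazure (Suc i)"
  have [simp]: "s x = y" "s y = x" "s z = z" "t x = x" "t y = z" "t z = y"
    by (auto simp: defs s_def t_def swap_vars_xvar Transposition.transpose_def)
  have hom [simp]: "s (f * g) = s f * s g" "s (f - g) = s f - s g" "s (s f) = f"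
    "t (f * g) = t f * t g" "t (f - g) = t f - t g" "t (t f) = f" for f g
    by (simp_all add: s_def t_def swap_vars_mult swap_vars_diff)
  have br: "s (t (s f)) = t (s (t f))"
    by (simp add: s_def t_def swap_vars_braid)
  have I: "(x - y) * A g = x * g - y * s g" for g
    unfolding defs A_def s_def by (rule demazure_mult)
  have J: "(y - z) * B g = y * g - z * t g" for g
    unfolding defs B_def t_def by (rule demazure_mult)
  have nz: "x - y \<noteq> 0" "y - z \<noteq> 0" "x - z \<noteq> 0"
    by (simp_all add: defs xvar_eq_iff)
  define D where "D = (x - y) * (y - z) * (x - z)"
  define S where "S = x * (x * (y * f)) - y * (y * (x * s f)) - x * (x * (z * t f))
    + y * (y * (z * s (t f))) + z * (z * (x * t (s f))) - z * (z * (y * t (s (t f))))"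
  have tI: "(x - z) * t (A g) = x * t g - z * t (s g)" for g
    using arg_cong[OF I[of g], of t] by simp
  have stI: "(y - z) * s (t (A g)) = y * s (t g) - z * s (t (s g))" for g
    using arg_cong[OF tI[of g], of s] by simp
  have sJ: "(x - z) * s (B g) = x * s g - z * s (t g)" for g
    using arg_cong[OF J[of g], of s] by simp
  have tsJ: "(x - y) * t (s (B g)) = x * t (s g) - y * t (s (t g))" for g
    using arg_cong[OF sJ[of g], of t] by simp
  have sa: "(x - y) * s (A f) = x * f - y * s f"
    using arg_cong[OF I[of f], of s] by (simp add: algebra_simps)
  have tb: "(y - z) * t (B f) = y * f - z * t f"
    using arg_cong[OF J[of f], of t] by (simp add: algebra_simps)
  have 1: "(x - y) * (D * A (B (A f))) = (x - y) * S"
  proof -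
    have "(x - y) * (D * A (B (A f))) = D * ((x - y) * A (B (A f)))"
      by (simp only: ac_simps)
    also have "\<dots> = x * (x - y) * (x - z) * ((y - z) * B (A f))
        - y * (x - y) * (y - z) * ((x - z) * s (B (A f)))"
      unfolding I D_def by (simp only: algebra_simps)
    also have "\<dots> = x * y * (x - z) * ((x - y) * A f) - x * z * (x - y) * ((x - z) * t (A f))
        - x * y * (y - z) * ((x - y) * s (A f)) + y * z * (x - y) * ((y - z) * s (t (A f)))"
      unfolding J sJ by (simp only: algebra_simps)
    also have "\<dots> = (x - y) * S"
      unfolding I tI sa stI S_def br by (simp only: algebra_simps)
    finally show ?thesis .
  qed
  have 2: "(y - z) * (D * B (A (B f))) = (y - z) * S"
  proof -
    have "(y - z) * (D * B (A (B f))) = D * ((y - z) * B (A (B f)))"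
      by (simp only: ac_simps)
    also have "\<dots> = y * (y - z) * (x - z) * ((x - y) * A (B f))
        - z * (x - y) * (y - z) * ((x - z) * t (A (B f)))"
      unfolding J D_def by (simp only: algebra_simps)
    also have "\<dots> = x * y * (x - z) * ((y - z) * B f) - y * y * (y - z) * ((x - z) * s (B f))
        - x * z * (x - y) * ((y - z) * t (B f)) + z * z * (y - z) * ((x - y) * t (s (B f)))"
      unfolding I tI by (simp only: algebra_simps)
    also have "\<dots> = (y - z) * S"
      unfolding J sJ tb tsJ S_def by (simp only: algebra_simps)
    finally show ?thesis .
  qed
  have "D * A (B (A f)) = S" "D * B (A (B f)) = S"
    using 1 2 nz by simp_all
  moreover have "D \<noteq> 0"
    using nz by (simp add: D_def)
  ultimately show ?thesis
    unfolding A_def B_def by (metis mult_left_cancel)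
qed

subsection \<open>Key polynomials are well defined\<close>

lemma length_swap_parts [simp]: "length (swap_parts i \<alpha>) = length \<alpha>"
  by (simp add: swap_parts_def)

lemma nth_swap_parts:
  "Suc i < length \<alpha> \<Longrightarrow> j < length \<alpha> \<Longrightarrow> swap_parts i \<alpha> ! j = \<alpha> ! (tr i j)"
  by (auto simp: swap_parts_def nth_list_update Transposition.transpose_def)

definition weight :: "nat list \<Rightarrow> nat" where
  "weight \<alpha> = (\<Sum>j<length \<alpha>. j * \<alpha> ! j)"

lemma weight_swap_parts:
  assumes "Suc i < length \<alpha>" "\<alpha> ! i < \<alpha> ! Suc i"
  shows "weight (swap_parts i \<alpha>) < weight \<alpha>"
proof -
  let ?R = "{..<length \<alpha>} - {i, Suc i}"
  have split: "{..<length \<alpha>} = insert i (insert (Suc i) ?R)"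
    using assms by auto
  have sum: "(\<Sum>j<length \<alpha>. g j) = g i + (g (Suc i) + sum g ?R)" for g :: "nat \<Rightarrow> nat"
    by (subst split) simp
  have "(\<Sum>j\<in>?R. j * swap_parts i \<alpha> ! j) = (\<Sum>j\<in>?R. j * \<alpha> ! j)"
    using assms by (intro sum.cong) (auto simp: nth_swap_parts Transposition.transpose_def)
  then show ?thesis
    using assms by (simp add: weight_def sum nth_swap_parts)
qed

lemma decreasing_or_ascent:
  "sorted_wrt (\<ge>) \<alpha> \<longleftrightarrow> \<not> (\<exists>i. Suc i < length \<alpha> \<and> \<alpha> ! i < \<alpha> ! Suc i)"
  for \<alpha> :: "nat list"
proof -
  have "transp ((\<ge>) :: nat \<Rightarrow> nat \<Rightarrow> bool)"
    by (auto simp: transp_def)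
  then show ?thesis
    by (simp add: sorted_wrt_iff_nth_Suc_transp not_less) (metis not_le)
qed

lemma ex_is_key_poly: "\<exists>f. is_key_poly \<alpha> f"
proof (induction "weight \<alpha>" arbitrary: \<alpha> rule: less_induct)
  case less
  show ?case
  proof (cases "sorted_wrt (\<ge>) \<alpha>")
    case True
    then show ?thesis
      by (blast intro: is_key_poly.decreasing)
  next
    case False
    then obtain i where i: "Suc i < length \<alpha>" "\<alpha> ! i < \<alpha> ! Suc i"
      using decreasing_or_ascent by blast
    then show ?thesis
      using less[OF weight_swap_parts[OF i]] is_key_poly.ascent[OF i] by blast
  qed
qed

lemma swap_parts_commute:
  assumes "Suc i < j" "Suc j < length \<alpha>"
  shows "swap_parts i (swap_parts j \<alpha>) = swap_parts j (swap_parts i \<alpha>)"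
  using assms
  by (intro nth_equalityI) (auto simp: nth_swap_parts Transposition.transpose_def)

lemma swap_parts_braid:
  assumes "Suc (Suc i) < length \<alpha>"
  shows "swap_parts i (swap_parts (Suc i) (swap_parts i \<alpha>))
       = swap_parts (Suc i) (swap_parts i (swap_parts (Suc i) \<alpha>))"
  using assms
  by (intro nth_equalityI) (auto simp: nth_swap_parts Transposition.transpose_def)

lemma is_key_poly_unique:
  assumes "is_key_poly \<alpha> f" "is_key_poly \<alpha> g"
  shows "f = g"
  using assms
proof (induction "weight \<alpha>" arbitrary: \<alpha> f g rule: less_induct)
  case less
  let ?asc = "\<lambda>i (\<alpha>::nat list). Suc i < length \<alpha> \<and> \<alpha> ! i < \<alpha> ! Suc i"
  have smaller: "f = g"
    if "is_key_poly (swap_parts i \<alpha>) f" "is_key_poly (swap_parts i \<alpha>) g" "?asc i \<alpha>" for i f g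
    using less.hyps that weight_swap_parts by blast
  have main: "demazure i f = demazure j g"
    if "i < j" "?asc i \<alpha>" "?asc j \<alpha>"
      and f: "is_key_poly (swap_parts i \<alpha>) f" and g: "is_key_poly (swap_parts j \<alpha>) g" for i j f g
  proof (cases "j = Suc i")
    case False
    then have ij: "Suc i < j"
      using that by simp
    obtain k where k: "is_key_poly (swap_parts i (swap_parts j \<alpha>)) k"
      using ex_is_key_poly by blast
    have "?asc j (swap_parts i \<alpha>)" "?asc i (swap_parts j \<alpha>)"
      using that ij by (auto simp: nth_swap_parts Transposition.transpose_def)
    then have "is_key_poly (swap_parts i \<alpha>) (demazure j k)"
      "is_key_poly (swap_parts j \<alpha>) (demazure i k)"
      using k swap_parts_commute[OF ij] that by (auto intro: is_key_poly.ascent)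
    then have "f = demazure j k" "g = demazure i k"
      using smaller f g that by blast+
    then show ?thesis
      by (simp add: demazure_commute[OF ij])
  next
    case True
    let ?L = "swap_parts (Suc i) (swap_parts i \<alpha>)" and ?R = "swap_parts i (swap_parts (Suc i) \<alpha>)"
    have len: "Suc (Suc i) < length \<alpha>"
      using that True by simp
    obtain k where k: "is_key_poly (swap_parts i ?L) k"
      using ex_is_key_poly by blast
    have asc: "?asc (Suc i) (swap_parts i \<alpha>)" "?asc i ?L"
      "?asc i (swap_parts (Suc i) \<alpha>)" "?asc (Suc i) ?R"
      using that True by (auto simp: nth_swap_parts Transposition.transpose_def)
    have "is_key_poly (swap_parts i \<alpha>) (demazure (Suc i) (demazure i k))"
      using k asc by (blast intro: is_key_poly.ascent)
    moreover have "is_key_poly (swap_parts (Suc i) \<alpha>) (demazure i (demazure (Suc i) k))"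
      using k asc unfolding swap_parts_braid[OF len] by (blast intro: is_key_poly.ascent)
    ultimately have "f = demazure (Suc i) (demazure i k)" "g = demazure i (demazure (Suc i) k)"
      using smaller f g that True by blast+
    then show ?thesis
      by (simp add: demazure_braid True)
  qed
  show ?case
    using less.prems(1)
  proof cases
    case decreasing
    then show ?thesis
      using less.prems(2) decreasing_or_ascent by (auto elim: is_key_poly.cases)
  next
    case (ascent i f')
    from less.prems(2) show ?thesis
    proof cases
      case decreasing
      then show ?thesis
        using ascent decreasing_or_ascent by blast
    next
      case (ascent j g')
      then show ?thesis
        using \<open>f = demazure i f'\<close> \<open>Suc i < length \<alpha>\<close> \<open>\<alpha> ! i < \<alpha> ! Suc i\<close>
          \<open>is_key_poly (swap_parts i \<alpha>) f'\<close> main[of i j f' g'] main[of j i g' f'] smaller[of i f' g']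
        by (metis linorder_neqE_nat)
    qed
  qed
qed

lemma ex1_is_key_poly: "\<exists>!f. is_key_poly \<alpha> f"
  using ex_is_key_poly is_key_poly_unique by blast

lemma is_key_poly_key_poly: "is_key_poly \<alpha> (key_poly \<alpha>)"
  unfolding key_poly_def by (rule theI'[OF ex1_is_key_poly])

lemma key_poly_decreasing: "sorted_wrt (\<ge>) \<alpha> \<Longrightarrow> key_poly \<alpha> = xmonom \<alpha>"
  using is_key_poly_key_poly is_key_poly_unique is_key_poly.decreasing by blast

lemma key_poly_ascent:
  "Suc i < length \<alpha> \<Longrightarrow> \<alpha> ! i < \<alpha> ! Suc i
     \<Longrightarrow> key_poly \<alpha> = demazure i (key_poly (swap_parts i \<alpha>))"
  using is_key_poly_key_poly is_key_poly_unique is_key_poly.ascent by blast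

end

theory Submission
  imports Defs
begin

text \<open>
  For large \<open>N\<close> the word that sorts \<open>N\<alpha>+\<beta>\<close> does not change. So one fixed product of factors
  \<open>x\<^sub>a - x\<^sub>b\<close> with \<open>a < b\<close> turns the key polynomial into a fixed integer combination of monomials
  whose exponents are affine in \<open>N\<close>. Inverting the product expresses the coefficient through
  values \<open>K (N u + v)\<close> of the vector partition function \<open>K\<close> of a family of roots.
  For a root \<open>g\<close> of the family, \<open>K y - K (y - g)\<close> is the vector partition function of the
  family without \<open>g\<close>, so by induction \<open>K (N u + v) - K (N u + v - w)\<close> is eventually polynomial for
  every \<open>w\<close> in the lattice spanned by the roots. If \<open>u\<close> lies in this lattice, take \<open>w = u\<close>:
  the function \<open>K (N u + v)\<close> has an eventually polynomial difference in \<open>N\<close>. Otherwise it vanishes for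
  large \<open>N\<close>, because this lattice is saturated in type A: it is cut out by the vanishing of the sums of
  entries over the connected components of the graph of roots. Saturation is what excludes a proper
  quasi-polynomial.
\<close>

subsection \<open>Eventually polynomial functions\<close>

text \<open>Rational coefficients admit integer-valued polynomials such as N(N-1)/2.\<close>

definition evpoly :: "(nat \<Rightarrow> int) \<Rightarrow> bool" where
  "evpoly f \<longleftrightarrow> (\<exists>P :: rat poly. \<forall>\<^sub>F N in sequentially. of_int (f N) = poly P (of_nat N))"

lemma evpoly_cong:
  assumes "evpoly f" "\<forall>\<^sub>F N in sequentially. g N = f N"
  shows "evpoly g"
proof -
  obtain P :: "rat poly" where "\<forall>\<^sub>F N in sequentially. of_int (f N) = poly P (of_nat N)"
    using assms(1) by (auto simp: evpoly_def)
  with assms(2) have "\<forall>\<^sub>F N in sequentially. of_int (g N) = poly P (of_nat N)"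
    by eventually_elim simp
  then show ?thesis
    by (auto simp: evpoly_def)
qed

lemma evpoly_const: "evpoly (\<lambda>_. c)"
  unfolding evpoly_def by (rule exI[of _ "[:of_int c:]"]) simp

lemma evpoly_diff:
  assumes "evpoly f" "evpoly g"
  shows "evpoly (\<lambda>N. f N - g N)"
proof -
  obtain P Q :: "rat poly" where
    "\<forall>\<^sub>F N in sequentially. of_int (f N) = poly P (of_nat N)"
    "\<forall>\<^sub>F N in sequentially. of_int (g N) = poly Q (of_nat N)"
    using assms by (auto simp: evpoly_def)
  then have "\<forall>\<^sub>F N in sequentially. of_int (f N - g N) = poly (P - Q) (of_nat N)"
    by eventually_elim simp
  then show ?thesis
    unfolding evpoly_def by blast
qed

text \<open>By the binomial theorem, (x+1)^(n+1) - x^(n+1) is (n+1) x^n plus multiples of lower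
  powers. Subtracting antidifferences of the latter, known by induction, and dividing by n+1 leaves
  x^n.\<close>

lemma ex_antidifference_monom:
  "\<exists>Q :: rat poly. \<forall>x. poly Q (x + 1) - poly Q x = x ^ n"
proof (induction n rule: less_induct)
  case (less n)
  then obtain Q :: "nat \<Rightarrow> rat poly"
    where Q: "\<And>k x. k < n \<Longrightarrow> poly (Q k) (x + 1) - poly (Q k) x = x ^ k"
    by metis
  let ?c = "\<lambda>k. of_nat (Suc n choose k) :: rat"
  let ?R = "smult (1 / of_nat (Suc n)) (monom 1 (Suc n) - (\<Sum>k<n. smult (?c k) (Q k)))"
  have "poly ?R (x + 1) - poly ?R x = x ^ n" for x
  proof -
    have "(x + 1) ^ Suc n = (\<Sum>k\<le>Suc n. ?c k * x ^ k)"
      using binomial_ring[of x 1 "Suc n"] by simp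
    also have "\<dots> = (\<Sum>k<n. ?c k * x ^ k) + of_nat (Suc n) * x ^ n + x ^ Suc n"
      by (simp add: lessThan_Suc_atMost[symmetric])
    finally have 1: "(x + 1) ^ Suc n - x ^ Suc n - (\<Sum>k<n. ?c k * x ^ k) = of_nat (Suc n) * x ^ n"
      by simp
    have 2: "(\<Sum>k<n. ?c k * x ^ k)
        = (\<Sum>k<n. ?c k * poly (Q k) (x + 1)) - (\<Sum>k<n. ?c k * poly (Q k) x)"
      unfolding sum_subtractf[symmetric]
      by (intro sum.cong refl) (metis Q lessThan_iff right_diff_distrib)
    have R: "of_nat (Suc n) * poly ?R y = y ^ Suc n - (\<Sum>k<n. ?c k * poly (Q k) y)" for y
      by (simp add: poly_monom poly_sum del: of_nat_Suc power_Suc)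
    have "of_nat (Suc n) * (poly ?R (x + 1) - poly ?R x) = of_nat (Suc n) * x ^ n"
      unfolding right_diff_distrib R using 1 unfolding 2 by linarith
    moreover have "of_nat (Suc n) \<noteq> (0 :: rat)"
      by (simp del: of_nat_Suc)
    ultimately show ?thesis
      by (simp only: mult_cancel_left simp_thms)
  qed
  then show ?case
    by blast
qed

lemma ex_antidifference:
  fixes P :: "rat poly"
  obtains Q where "\<And>x. poly Q (x + 1) - poly Q x = poly P x"
proof -
  obtain M :: "nat \<Rightarrow> rat poly" where M: "\<And>n x. poly (M n) (x + 1) - poly (M n) x = x ^ n"
    using ex_antidifference_monom by metis
  define Q where "Q = (\<Sum>i\<le>degree P. smult (coeff P i) (M i))"
  have "poly Q (x + 1) - poly Q x
      = (\<Sum>i\<le>degree P. coeff P i * (poly (M i) (x + 1) - poly (M i) x))" for x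
    by (simp add: Q_def poly_sum right_diff_distrib sum_subtractf)
  then have "poly Q (x + 1) - poly Q x = poly P x" for x
    by (simp add: M poly_altdef[of P])
  then show ?thesis
    by (rule that)
qed

text \<open>From some \<open>N0\<close> on, subtracting an antidifference of the polynomial leaves a
  constant.\<close>

lemma evpoly_if_difference:
  assumes "evpoly (\<lambda>N. f (Suc N) - f N)"
  shows "evpoly f"
proof -
  obtain P :: "rat poly" where
    "\<forall>\<^sub>F N in sequentially. of_int (f (Suc N) - f N) = poly P (of_nat N)"
    using assms by (auto simp: evpoly_def)
  then obtain N0 where P: "\<And>N. N \<ge> N0 \<Longrightarrow> of_int (f (Suc N) - f N) = poly P (of_nat N)"
    by (auto simp: eventually_sequentially)
  obtain Q where Q: "\<And>x. poly Q (x + 1) - poly Q x = poly P x"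
    using ex_antidifference by blast
  let ?c = "of_int (f N0) - poly Q (of_nat N0)"
  have "of_int (f N) - poly Q (of_nat N) = ?c" if "N \<ge> N0" for N
    using that
  proof (induction N rule: dec_induct)
    case (step N)
    then show ?case
      using P[of N] Q[of "of_nat N"] by (simp add: algebra_simps)
  qed simp
  then have "of_int (f N) = poly (Q + [:?c:]) (of_nat N)" if "N \<ge> N0" for N
    using that by (simp add: algebra_simps)
  then show ?thesis
    unfolding evpoly_def eventually_sequentially by blast
qed

subsection \<open>The vector partition function of a family of roots\<close>

type_synonym ivec = "nat \<Rightarrow>\<^sub>0 int"

text \<open>Multiplicities vanish outside \<open>I\<close>, so each partition is represented by
  exactly one function and cardinality counts correctly.\<close>

definition vector_partitions :: "nat set \<Rightarrow> (nat \<Rightarrow> ivec) \<Rightarrow> ivec \<Rightarrow> (nat \<Rightarrow> nat) set" where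
  "vector_partitions I g y =
     {t. (\<forall>k. k \<notin> I \<longrightarrow> t k = 0) \<and> (\<Sum>k\<in>I. frag_cmul (int (t k)) (g k)) = y}"

definition partition_fun :: "nat set \<Rightarrow> (nat \<Rightarrow> ivec) \<Rightarrow> ivec \<Rightarrow> int" where
  "partition_fun I g y = int (card (vector_partitions I g y))"

definition root :: "nat \<times> nat \<Rightarrow> ivec" where
  "root e = frag_of (snd e) - frag_of (fst e)"

text \<open>Giving basis vector i the weight i makes every root have positive weight, so the weight
  of \<open>y\<close> bounds each multiplicity. Finiteness makes \<open>card\<close> in
  \<open>partition_fun\<close> an honest count.\<close>

lemma finite_vector_partitions:
  assumes "finite I" "\<And>k. k \<in> I \<Longrightarrow> fst (e k) < snd (e k)"
  shows "finite (vector_partitions I (\<lambda>k. root (e k)) y)"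
proof -
  \<comment> \<open>\<open>frag_extend\<close> takes values in a free abelian group, so weights are
    encoded as multiples of the single generator 0 and read off there.\<close>
  define \<omega> :: "ivec \<Rightarrow> int" where
    "\<omega> x = Poly_Mapping.lookup (frag_extend (\<lambda>i. frag_cmul (int i) (frag_of (0::nat))) x) 0" for x
  have \<omega>_sum: "\<omega> (\<Sum>k\<in>I. frag_cmul (c k) (root (e k)))
      = (\<Sum>k\<in>I. c k * (int (snd (e k)) - int (fst (e k))))" for c
    by (simp add: \<omega>_def frag_extend_sum assms frag_extend_cmul lookup_sum root_def
        frag_extend_diff lookup_minus)
  have "vector_partitions I (\<lambda>k. root (e k)) y
      \<subseteq> {t. \<forall>k. (k \<in> I \<longrightarrow> t k \<in> {..nat (\<omega> y)}) \<and> (k \<notin> I \<longrightarrow> t k = 0)}"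
  proof
    fix t assume t: "t \<in> vector_partitions I (\<lambda>k. root (e k)) y"
    let ?s = "\<lambda>k. int (t k) * (int (snd (e k)) - int (fst (e k)))"
    have nn: "0 \<le> ?s j" if "j \<in> I" for j
      using assms(2)[OF that] by simp
    have "t k \<le> nat (\<omega> y)" if k: "k \<in> I" for k
    proof -
      have "int (t k) * 1 \<le> ?s k"
        using assms(2)[OF k] by (intro mult_left_mono) auto
      also have "\<dots> \<le> (\<Sum>k\<in>I. ?s k)"
        using nn assms k by (intro member_le_sum) auto
      also have "\<dots> = \<omega> y"
        using t \<omega>_sum[of "\<lambda>k. int (t k)"] by (simp add: vector_partitions_def)
      finally show ?thesis
        by simp
    qed
    then show "t \<in> {t. \<forall>k. (k \<in> I \<longrightarrow> t k \<in> {..nat (\<omega> y)}) \<and> (k \<notin> I \<longrightarrow> t k = 0)}"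
      using t by (simp add: vector_partitions_def)
  qed
  then show ?thesis
    by (rule finite_subset) (rule finite_set_of_finite_funs[OF assms(1)], simp)
qed

lemma partition_fun_empty: "partition_fun {} g y = (if y = 0 then 1 else 0)"
proof -
  have "vector_partitions {} g y = (if y = 0 then {\<lambda>_. 0} else {})"
    by (auto simp: vector_partitions_def)
  then show ?thesis
    by (simp add: partition_fun_def)
qed

lemma partition_fun_delete:
  assumes "finite I" "\<And>k. k \<in> I \<Longrightarrow> fst (e k) < snd (e k)" "k \<in> I"
  defines "g \<equiv> \<lambda>k. root (e k)"
  shows "partition_fun I g y = partition_fun (I - {k}) g y + partition_fun I g (y - g k)"
proof -
  let ?up = "\<lambda>t::nat \<Rightarrow> nat. t(k := Suc (t k))"
  have sumI: "(\<Sum>j\<in>I. frag_cmul (int (t j)) (g j))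
      = frag_cmul (int (t k)) (g k) + (\<Sum>j\<in>I-{k}. frag_cmul (int (t j)) (g j))" for t
    using assms by (simp add: sum.remove)
  have up: "?up t \<in> vector_partitions I g y \<longleftrightarrow> t \<in> vector_partitions I g (y - g k)" for t
  proof -
    have "(\<Sum>j\<in>I. frag_cmul (int (?up t j)) (g j)) = (\<Sum>j\<in>I. frag_cmul (int (t j)) (g j)) + g k"
      unfolding sumI by (simp add: frag_cmul_distrib)
    then have "(\<Sum>j\<in>I. frag_cmul (int (?up t j)) (g j)) = y
        \<longleftrightarrow> (\<Sum>j\<in>I. frag_cmul (int (t j)) (g j)) = y - g k"
      by (simp only: eq_diff_eq)
    moreover have "(\<forall>j. j \<notin> I \<longrightarrow> ?up t j = 0) \<longleftrightarrow> (\<forall>j. j \<notin> I \<longrightarrow> t j = 0)"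
      using assms(3) by (intro iff_allI) auto
    ultimately show ?thesis
      unfolding vector_partitions_def by simp
  qed
  have low: "t \<in> vector_partitions (I - {k}) g y \<longleftrightarrow> t \<in> vector_partitions I g y \<and> t k = 0" for t
  proof -
    have "(\<forall>j. j \<notin> I - {k} \<longrightarrow> t j = 0) \<longleftrightarrow> (\<forall>j. j \<notin> I \<longrightarrow> t j = 0) \<and> t k = 0"
      using assms(3) by auto
    moreover have "(\<Sum>j\<in>I - {k}. frag_cmul (int (t j)) (g j)) = (\<Sum>j\<in>I. frag_cmul (int (t j)) (g j))"
      if "t k = 0"
      unfolding sumI by (simp add: that)
    ultimately show ?thesis
      unfolding vector_partitions_def by auto
  qed
  have "vector_partitions I g y
      = vector_partitions (I - {k}) g y \<union> ?up ` vector_partitions I g (y - g k)" (is "?S = ?A \<union> ?B")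
  proof (intro equalityI subsetI)
    fix t assume t: "t \<in> ?S"
    show "t \<in> ?A \<union> ?B"
    proof (cases "t k")
      case 0
      then have "t \<in> ?A"
        using t low by blast
      then show ?thesis ..
    next
      case (Suc n)
      then have eq: "t = ?up (t(k := n))"
        by (simp add: fun_upd_idem)
      then have "t(k := n) \<in> vector_partitions I g (y - g k)"
        using t up[of "t(k := n)"] by simp
      with eq show ?thesis
        by (intro UnI2 image_eqI)
    qed
  next
    fix t assume "t \<in> ?A \<union> ?B"
    then show "t \<in> ?S"
      using up low by blast
  qed
  moreover have "?A \<inter> ?B = {}"
    using low by fastforce
  moreover have "finite ?A" "finite ?B"
    unfolding g_def using assms by (auto intro!: finite_imageI finite_vector_partitions)
  moreover have "card ?B = card (vector_partitions I g (y - g k))"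
  proof (intro card_image inj_onI ext)
    fix t t' x assume "?up t = ?up t'"
    from fun_cong[OF this, of x] show "t x = t' x"
      by (cases "x = k") auto
  qed
  ultimately show ?thesis
    by (simp add: partition_fun_def card_Un_disjoint)
qed

text \<open>
  \<open>r\<close> sends each vertex to a representative of its connected component in the graph with edges \<open>e k\<close>;
  the properties \<open>Q\<close> of interest hold on an additive group containing the roots.
\<close>

lemma ex_merge_map:
  assumes "finite I" and Q: "Q 0" "\<And>v w. Q v \<Longrightarrow> Q w \<Longrightarrow> Q (v - w)"
    and "\<And>k. k \<in> I \<Longrightarrow> Q (root (e k))"
  obtains r :: "nat \<Rightarrow> nat" where "\<And>k. k \<in> I \<Longrightarrow> r (fst (e k)) = r (snd (e k))"
    "\<And>i. Q (frag_of i - frag_of (r i))"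
proof -
  have add: "Q (v + w)" if "Q v" "Q w" for v w
    using Q(2)[OF that(1) Q(2)[OF Q(1) that(2)]] by simp
  have "\<exists>r. (\<forall>k\<in>I. r (fst (e k)) = r (snd (e k))) \<and> (\<forall>i. Q (frag_of i - frag_of (r i)))"
    using assms(1,4)
  proof (induction I rule: finite_induct)
    case empty
    show ?case
      by (rule exI[of _ id]) (simp add: Q)
  next
    case (insert k I)
    then obtain r where r: "\<And>k. k \<in> I \<Longrightarrow> r (fst (e k)) = r (snd (e k))"
      and Qr: "\<And>i. Q (frag_of i - frag_of (r i))"
      by blast
    define a b where "a = fst (e k)" and "b = snd (e k)"
    \<comment> \<open>The new edge joins the components of a and b: whatever was represented by
      \<open>r b\<close> is now represented by \<open>r a\<close>.\<close>
    define r' where "r' i = (if r i = r b then r a else r i)" for i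
    have "Q (frag_of i - frag_of (r' i))" for i
    proof (cases "r i = r b")
      case True
      \<comment> \<open>As \<open>r i = r b\<close>, the sum telescopes to the difference of the
        basis vectors at i and \<open>r a\<close>, passing through the new edge.\<close>
      have "Q ((frag_of i - frag_of (r i)) - (frag_of b - frag_of (r b))
          + ((frag_of b - frag_of a) + (frag_of a - frag_of (r a))))"
        using insert.prems[of k]
        by (intro add[OF Q(2)[OF Qr Qr] add[OF _ Qr]]) (simp add: root_def a_def b_def)
      then show ?thesis
        by (simp add: True r'_def)
    qed (simp add: r'_def Qr)
    moreover have "r' (fst (e j)) = r' (snd (e j))" if "j \<in> insert k I" for j
      using that r by (auto simp: r'_def a_def b_def)
    ultimately show ?case
      by blast
  qed
  then show ?thesis
    using that by blast
qed

section \<open>Vector partition functions along a ray\<close>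

lemma eventually_affine_nonzero:
  assumes "u \<noteq> (0 :: ivec)"
  shows "\<forall>\<^sub>F N in sequentially. frag_cmul (int N) u + v \<noteq> 0"
proof -
  obtain x where x: "Poly_Mapping.lookup u x \<noteq> 0"
    using assms by (metis poly_mapping_eqI lookup_zero)
  let ?p = "Poly_Mapping.lookup u x" and ?q = "Poly_Mapping.lookup v x"
  have "frag_cmul (int N) u + v \<noteq> 0" if "N > nat \<bar>?q\<bar>" for N
  proof
    assume "frag_cmul (int N) u + v = 0"
    then have "Poly_Mapping.lookup (frag_cmul (int N) u + v) x = 0"
      by simp
    then have "int N * ?p = - ?q"
      by (simp add: lookup_add)
    then have "int N * \<bar>?p\<bar> = \<bar>?q\<bar>"
      by (metis abs_minus_cancel abs_mult abs_of_nat)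
    moreover have "int N * 1 \<le> int N * \<bar>?p\<bar>"
      using x by (intro mult_left_mono) auto
    ultimately show False
      using that by simp
  qed
  then show ?thesis
    by (intro eventually_sequentiallyI[of "Suc (nat \<bar>?q\<bar>)"]) auto
qed

text \<open>Induction on the number of roots with the direction \<open>u\<close> fixed; the base
  point \<open>v\<close> is general because the argument shifts it.\<close>

lemma evpoly_partition_fun:
  assumes "finite I" "\<And>k. k \<in> I \<Longrightarrow> fst (e k) < snd (e k)"
  shows "evpoly (\<lambda>N. partition_fun I (\<lambda>k. root (e k)) (frag_cmul (int N) u + v))"
  using assms
proof (induction "card I" arbitrary: I v)
  case 0
  then have I: "I = {}"
    by simp
  show ?case
  proof (cases "u = 0")
    case True
    then show ?thesis
      by (simp add: evpoly_const)
  next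
    case False
    from eventually_affine_nonzero[OF this, of v] show ?thesis
      by (intro evpoly_cong[OF evpoly_const[of 0]], elim eventually_mono)
        (simp add: I partition_fun_empty)
  qed
next
  case (Suc n)
  define g where "g = (\<lambda>k. root (e k))"
  define K where "K = partition_fun I g"
  \<comment> \<open>The shifts that change \<open>K\<close> along every ray of direction
    \<open>u\<close> only by an eventually polynomial function. Ranging over all \<open>v\<close> is
    what makes them a group.\<close>
  define Q where "Q w \<longleftrightarrow> (\<forall>v. evpoly (\<lambda>N. K (frag_cmul (int N) u + v) - K (frag_cmul (int N) u + v - w)))" for w
  have Q0: "Q 0"
    by (simp add: Q_def evpoly_const)
  have Qdiff: "Q (x - w)" if x: "Q x" and w: "Q w" for x w
    unfolding Q_def
  proof
    fix v
    \<comment> \<open>Shift down by x from \<open>v\<close>, then undo the w-shift from the base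
      point \<open>v - x + w\<close>; the values at \<open>v - x\<close> cancel.\<close>
    have "evpoly (\<lambda>N. (K (frag_cmul (int N) u + v) - K (frag_cmul (int N) u + v - x))
       - (K (frag_cmul (int N) u + (v - x + w)) - K (frag_cmul (int N) u + (v - x + w) - w)))"
      by (rule evpoly_diff) (use x w in \<open>auto simp only: Q_def\<close>)
    then show "evpoly (\<lambda>N. K (frag_cmul (int N) u + v) - K (frag_cmul (int N) u + v - (x - w)))"
      by (simp add: algebra_simps)
  qed
  have Qg: "Q (root (e k))" if k: "k \<in> I" for k
  proof -
    have "K y - K (y - root (e k)) = partition_fun (I - {k}) g y" for y
      using partition_fun_delete[of I e k y] Suc.prems k by (simp add: K_def g_def)
    moreover have "n = card (I - {k})"
      using Suc.hyps(2) Suc.prems k by simp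
    then have "evpoly (\<lambda>N. partition_fun (I - {k}) g (frag_cmul (int N) u + v))" for v
      using Suc.hyps(1)[of "I - {k}"] Suc.prems by (simp add: g_def)
    ultimately show ?thesis
      by (simp add: Q_def)
  qed
  obtain r where r: "\<And>k. k \<in> I \<Longrightarrow> r (fst (e k)) = r (snd (e k))"
    and Qr: "\<And>i. Q (frag_of i - frag_of (r i))"
    using ex_merge_map[of I Q e, OF Suc.prems(1) Q0 Qdiff Qg] by blast
  \<comment> \<open>Contracting each component to its representative kills all roots, so only
    vectors in the kernel of this map can have partitions.\<close>
  define \<rho> where "\<rho> = frag_extend (\<lambda>i. frag_of (r i))"
  have \<rho>_solution: "\<rho> y = 0" if "t \<in> vector_partitions I g y" for t y
  proof -
    have "\<rho> y = \<rho> (\<Sum>k\<in>I. frag_cmul (int (t k)) (g k))"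
      using that by (simp add: vector_partitions_def)
    also have "\<dots> = 0"
      by (simp add: \<rho>_def g_def root_def frag_extend_sum Suc.prems frag_extend_cmul
        frag_extend_diff r)
    finally show ?thesis .
  qed
  have K_zero: "K y = 0" if "\<rho> y \<noteq> 0" for y
  proof -
    have "vector_partitions I g y = {}"
      using \<rho>_solution that by blast
    then show ?thesis
      by (simp add: K_def partition_fun_def)
  qed
  have "evpoly (\<lambda>N. K (frag_cmul (int N) u + v))"
  proof (cases "\<rho> u = 0")
    case False
    have "\<forall>\<^sub>F N in sequentially. frag_cmul (int N) (\<rho> u) + \<rho> v \<noteq> 0"
      by (rule eventually_affine_nonzero[OF False])
    then have "\<forall>\<^sub>F N in sequentially. K (frag_cmul (int N) u + v) = 0"
      by eventually_elim (rule K_zero, simp add: \<rho>_def frag_extend_add frag_extend_cmul)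
    then show ?thesis
      by (rule evpoly_cong[OF evpoly_const])
  next
    case True
    have Qcmul: "Q (frag_cmul c w)" if w: "Q w" for c w
    proof (induction c rule: int_induct[where k = 0])
      case (step1 c)
      then show ?case
        using Qdiff[OF step1(2) Qdiff[OF Q0 w]] by (simp add: frag_cmul_distrib)
    next
      case (step2 c)
      then show ?case
        using Qdiff[OF step2(2) w] by (simp add: frag_cmul_distrib algebra_simps frag_cmul_diff_distrib)
    qed (simp add: Q0)
    have Qsum: "Q (\<Sum>i\<in>A. f i)" if "\<And>i. Q (f i)" for A :: "nat set" and f
      by (induction A rule: infinite_finite_induct)
        (use that Q0 Qdiff[OF _ Qdiff[OF Q0]] in auto)
    \<comment> \<open>Saturation enters here: subtracting the zero vector \<open>\<rho> u\<close>
      writes \<open>u\<close> as an integral combination of differences already known to satisfy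
      \<open>Q\<close>.\<close>
    have "u = frag_extend (\<lambda>i. frag_of i) u - \<rho> u"
      by (simp add: True frag_expansion[symmetric])
    also have "\<dots> = (\<Sum>i\<in>Poly_Mapping.keys u. frag_cmul (Poly_Mapping.lookup u i) (frag_of i - frag_of (r i)))"
      unfolding \<rho>_def frag_extend_def sum_subtractf[symmetric]
      by (intro sum.cong refl poly_mapping_eqI) (simp add: lookup_minus right_diff_distrib)
    finally have u: "u = \<dots>" .
    have "Q u"
      by (subst u) (intro Qsum Qcmul Qr)
    \<comment> \<open>With base point \<open>v + u\<close>, the shift by \<open>u\<close> becomes
      the forward difference in N.\<close>
    have 1: "frag_cmul (int N) u + (v + u) - u = frag_cmul (int N) u + v"
      and 2: "frag_cmul (int N) u + (v + u) = frag_cmul (int (Suc N)) u + v" for N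
      by (simp_all add: frag_cmul_distrib ac_simps)
    have "evpoly (\<lambda>N. K (frag_cmul (int N) u + (v + u)) - K (frag_cmul (int N) u + (v + u) - u))"
      using \<open>Q u\<close> by (simp only: Q_def)
    then show ?thesis
      unfolding 1 unfolding 2 by (rule evpoly_if_difference)
  qed
  then show ?case
    by (simp add: K_def g_def)
qed

subsection \<open>Clearing denominators\<close>

text \<open>Integer exponents avoid truncated subtraction in differences of exponent
  vectors.\<close>

definition ivec_of :: "(nat \<Rightarrow>\<^sub>0 nat) \<Rightarrow> ivec" where
  "ivec_of m = Poly_Mapping.map int m"

lemma lookup_ivec_of [simp]: "Poly_Mapping.lookup (ivec_of m) i = int (Poly_Mapping.lookup m i)"
  by (simp add: ivec_of_def map.rep_eq when_def)

lemma ivec_of_add: "ivec_of (m + n) = ivec_of m + ivec_of n"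
  by (rule poly_mapping_eqI) (simp add: lookup_add)

lemma ivec_of_single: "ivec_of (Poly_Mapping.single i 1) = frag_of i"
  by (rule poly_mapping_eqI) (simp add: lookup_single when_def)

lemma ivec_of_eq_iff: "ivec_of m = ivec_of n \<longleftrightarrow> m = n"
proof
  assume "ivec_of m = ivec_of n"
  then have "int (Poly_Mapping.lookup m i) = int (Poly_Mapping.lookup n i)" for i
    by (metis lookup_ivec_of)
  then show "m = n"
    by (intro poly_mapping_eqI) simp
qed simp

text \<open>The coefficient at \<open>y\<close> of the product of \<open>f\<close> with the formal
  series whose coefficients are given by \<open>K\<close>.\<close>

definition conv :: "(ivec \<Rightarrow> int) \<Rightarrow> mpol \<Rightarrow> ivec \<Rightarrow> int" where
  "conv K f y = (\<Sum>m\<in>Poly_Mapping.keys f. Poly_Mapping.lookup f m * K (y - ivec_of m))"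

lemma conv_superset:
  assumes "finite S" "Poly_Mapping.keys f \<subseteq> S"
  shows "conv K f y = (\<Sum>m\<in>S. Poly_Mapping.lookup f m * K (y - ivec_of m))"
  unfolding conv_def using assms by (intro sum.mono_neutral_left) (auto simp: in_keys_iff)

lemma conv_0 [simp]: "conv K 0 y = 0"
  by (simp add: conv_def)

lemma conv_single: "conv K (Poly_Mapping.single m 1) y = K (y - ivec_of m)"
  by (simp add: conv_def)

lemma conv_diff: "conv K (f - g) y = conv K f y - conv K g y"
proof -
  let ?S = "Poly_Mapping.keys f \<union> Poly_Mapping.keys g"
  have "Poly_Mapping.keys (f - g) \<subseteq> ?S"
    by (rule keys_diff)
  then show ?thesis
    by (simp add: conv_superset[of ?S] lookup_minus left_diff_distrib sum_subtractf)
qed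

lemma conv_diff_left: "conv (\<lambda>z. K z - L z) f y = conv K f y - conv L f y"
  by (simp add: conv_def right_diff_distrib sum_subtractf)

lemma conv_shift: "conv (\<lambda>z. K (z - v)) f y = conv K f (y - v)"
  by (simp add: conv_def algebra_simps)

lemma conv_xvar_mult: "conv K (xvar i * f) y = conv K f (y - frag_of i)"
proof (induction f rule: mpol_induct)
  case (single a)
  show ?case
    by (simp only: xvar_def mult_single mult_1 conv_single ivec_of_add ivec_of_single diff_diff_add)
qed (simp_all add: conv_diff right_diff_distrib)

lemma conv_delta: "conv (\<lambda>z. if z = 0 then 1 else 0) f (ivec_of m) = Poly_Mapping.lookup f m"
  by (induction f rule: mpol_induct)
    (auto simp: conv_single conv_diff lookup_minus lookup_single ivec_of_eq_iff when_def)

text \<open>\<open>edge_poly e\<close> is \<open>x\<^sub>a (1 - x\<^sup>r)\<close> with \<open>a = fst e\<close> and \<open>r = root e\<close>.\<close>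

definition edge_poly :: "nat \<times> nat \<Rightarrow> mpol" where
  "edge_poly e = xvar (fst e) - xvar (snd e)"

text \<open>The generating series of the partition function is the product of the geometric series
  1/(1 - x^r) over the roots r, so it inverts the edge polynomials up to their factors x_a. The
  shift of \<open>y\<close> accounts for those factors.\<close>

lemma conv_partition_fun_edge_polys:
  assumes "finite I" "\<And>k. k \<in> I \<Longrightarrow> fst (e k) < snd (e k)"
  shows "conv (partition_fun I (\<lambda>k. root (e k))) ((\<Prod>k\<in>I. edge_poly (e k)) * f)
      (y + (\<Sum>k\<in>I. frag_of (fst (e k)))) = conv (\<lambda>z. if z = 0 then 1 else 0) f y"
  using assms
proof (induction I arbitrary: y rule: finite_induct)
  case empty
  have "partition_fun {} (\<lambda>k. root (e k)) = (\<lambda>z. if z = 0 then 1 else 0)"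
    by (rule ext) (rule partition_fun_empty)
  then show ?case
    by simp
next
  case (insert k I)
  define K where "K = partition_fun (insert k I) (\<lambda>k. root (e k))"
  define g where "g = (\<Prod>k\<in>I. edge_poly (e k)) * f"
  define s where "s = y + (\<Sum>k\<in>I. frag_of (fst (e k)))"
  have del: "K z - K (z - root (e k)) = partition_fun I (\<lambda>k. root (e k)) z" for z
    using partition_fun_delete[of "insert k I" e k z] insert.prems insert.hyps by (simp add: K_def)
  \<comment> \<open>Multiplication by one edge polynomial becomes a difference of \<open>K\<close>
    along its root, which deletes that root from the family.\<close>
  have "conv K (edge_poly (e k) * g) (s + frag_of (fst (e k)))
      = conv K g s - conv K g (s - root (e k))"
    by (simp add: edge_poly_def left_diff_distrib conv_diff conv_xvar_mult root_def)
      (simp add: algebra_simps)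
  also have "\<dots> = conv (\<lambda>z. K z - K (z - root (e k))) g s"
    by (simp add: conv_diff_left conv_shift)
  also have "\<dots> = conv (\<lambda>z. if z = 0 then 1 else 0) f y"
    using insert.IH insert.prems by (simp add: del g_def s_def)
  finally show ?case
    using insert.hyps by (simp add: K_def g_def s_def ac_simps)
qed

text \<open>Fixed integer combinations of monomials with exponents affine in N, up to finitely many
  N. Generating them by differences turns each closure property into a short induction.\<close>

inductive affine_family :: "(nat \<Rightarrow> mpol) \<Rightarrow> bool" where
  monom: "\<forall>\<^sub>F N in sequentially. ivec_of (m N) = frag_cmul (int N) u + v
    \<Longrightarrow> affine_family (\<lambda>N. Poly_Mapping.single (m N) 1)"
| diff: "affine_family f \<Longrightarrow> affine_family g \<Longrightarrow> affine_family (\<lambda>N. f N - g N)"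
| cong: "affine_family f \<Longrightarrow> \<forall>\<^sub>F N in sequentially. g N = f N \<Longrightarrow> affine_family g"

lemma affine_family_zero: "affine_family f \<Longrightarrow> affine_family (\<lambda>_. 0)"
  using affine_family.diff[of f f] by simp

lemma affine_family_mult:
  assumes "affine_family f"
  shows "affine_family (\<lambda>N. p * f N)"
proof (induction p rule: mpol_induct)
  case zero
  show ?case
    using affine_family_zero[OF assms] by simp
next
  case (single a)
  show ?case
    using assms
  proof induction
    case (monom m u v)
    have "\<forall>\<^sub>F N in sequentially. ivec_of (a + m N) = frag_cmul (int N) u + (ivec_of a + v)"
      using monom by eventually_elim (simp add: ivec_of_add ac_simps)
    then have "affine_family (\<lambda>N. Poly_Mapping.single (a + m N) 1)"
      by (rule affine_family.monom)
    then show ?case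
      by (simp add: mult_single)
  next
    case (diff f g)
    show ?case
      using affine_family.diff[OF diff.IH] by (simp add: right_diff_distrib)
  next
    case (cong f g)
    \<comment> \<open>Here \<open>frag_of a\<close> is \<open>Poly_Mapping.single a 1\<close>, the
      monomial with exponent vector \<open>a\<close>.\<close>
    from cong.hyps(2) have "\<forall>\<^sub>F N in sequentially. frag_of a * g N = frag_of a * f N"
      by eventually_elim simp
    then show ?case
      by (rule affine_family.cong[OF cong.IH])
  qed
next
  case (diff p q)
  show ?case
    using affine_family.diff[OF diff] by (simp add: left_diff_distrib)
qed

lemma affine_family_swap_vars:
  assumes "affine_family f"
  shows "affine_family (\<lambda>N. swap_vars i (f N))"
  using assms
proof induction
  case (monom m u v)
  have "\<forall>\<^sub>F N in sequentially. ivec_of (Poly_Mapping.map_key (tr i) (m N))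
      = frag_cmul (int N) (Poly_Mapping.map_key (tr i) u) + Poly_Mapping.map_key (tr i) v"
    using monom
  proof eventually_elim
    case (elim N)
    have "Poly_Mapping.lookup (ivec_of (m N)) (tr i j)
        = Poly_Mapping.lookup (frag_cmul (int N) u + v) (tr i j)" for j
      by (simp only: elim)
    then show ?case
      by (intro poly_mapping_eqI) (simp add: lookup_add map_key.rep_eq inj_tr)
  qed
  then show ?case
    unfolding swap_vars_single by (rule affine_family.monom)
next
  case (diff f g)
  show ?case
    unfolding swap_vars_diff by (rule affine_family.diff[OF diff.IH])
next
  case (cong f g)
  from cong.hyps(2) have "\<forall>\<^sub>F N in sequentially. swap_vars i (g N) = swap_vars i (f N)"
    by eventually_elim simp
  then show ?case
    by (rule affine_family.cong[OF cong.IH])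
qed

text \<open>A monomial only translates the argument of \<open>K\<close>, and its affine exponent
  changes the direction as well as the base point; hence \<open>K\<close> is assumed to behave well
  along every ray.\<close>

lemma evpoly_conv_affine_family:
  assumes "affine_family f" and K: "\<And>u v. evpoly (\<lambda>N. K (frag_cmul (int N) u + v))"
  shows "evpoly (\<lambda>N. conv K (f N) (frag_cmul (int N) u + v))"
  using assms(1)
proof induction
  case (monom m u' v')
  from monom have "\<forall>\<^sub>F N in sequentially. conv K (Poly_Mapping.single (m N) 1) (frag_cmul (int N) u + v)
      = K (frag_cmul (int N) (u - u') + (v - v'))"
  proof eventually_elim
    case (elim N)
    have "frag_cmul (int N) u + v - (frag_cmul (int N) u' + v')
        = frag_cmul (int N) (u - u') + (v - v')"
      by (rule poly_mapping_eqI) (simp add: lookup_add lookup_minus algebra_simps)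
    then show ?case
      by (simp only: conv_single elim)
  qed
  then show ?case
    by (rule evpoly_cong[OF K])
next
  case (diff f g)
  show ?case
    unfolding conv_diff by (rule evpoly_diff[OF diff.IH])
next
  case (cong f g)
  from cong.hyps(2) have "\<forall>\<^sub>F N in sequentially. conv K (g N) (frag_cmul (int N) u + v)
      = conv K (f N) (frag_cmul (int N) u + v)"
    by eventually_elim simp
  then show ?case
    by (rule evpoly_cong[OF cong.IH])
qed

subsection \<open>Key polynomials along a ray\<close>

definition edges_poly :: "(nat \<times> nat) list \<Rightarrow> mpol" where
  "edges_poly E = prod_list (map edge_poly E)"

lemma edges_poly_simps [simp]:
  "edges_poly [] = 1" "edges_poly (e # E) = edge_poly e * edges_poly E"
  "edges_poly (E @ E') = edges_poly E * edges_poly E'"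
  by (simp_all add: edges_poly_def)

lemma swap_vars_1 [simp]: "swap_vars i 1 = 1"
  by (simp add: swap_vars_single map_key_zero inj_tr flip: single_one)

text \<open>The exchange permutes the variables in each factor; a factor whose indices come out in
  the wrong order is reversed at the cost of a sign. The signs are collected in
  \<open>s\<close>.\<close>

lemma swap_vars_edges_poly:
  assumes "\<forall>e\<in>set E. fst e < snd e"
  obtains E' s where "\<forall>e\<in>set E'. fst e < snd e" "swap_vars i (edges_poly E) = s * edges_poly E'"
    "s * s = 1"
proof -
  have "\<exists>E' s. (\<forall>e\<in>set E'. fst e < snd e) \<and> swap_vars i (edges_poly E) = s * edges_poly E' \<and> s * s = 1"
    using assms
  proof (induction E)
    case Nil
    show ?case
      by (rule exI[of _ "[]"], rule exI[of _ 1]) simp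
  next
    case (Cons e E)
    then obtain E' s where E': "\<forall>e\<in>set E'. fst e < snd e"
      "swap_vars i (edges_poly E) = s * edges_poly E'" "s * s = 1"
      by auto
    define a b where "a = tr i (fst e)" and "b = tr i (snd e)"
    have sw: "swap_vars i (edge_poly e) = xvar a - xvar b"
      by (simp add: edge_poly_def swap_vars_diff swap_vars_xvar a_def b_def)
    have "a \<noteq> b"
      using Cons.prems unfolding a_def b_def by (metis injD[OF inj_tr] less_irrefl list.set_intros(1))
    then consider "a < b" | "b < a"
      by linarith
    then show ?case
    proof cases
      case 1
      have "swap_vars i (edges_poly (e # E)) = s * edges_poly ((a, b) # E')"
        by (simp add: swap_vars_mult sw E'(2)) (simp add: edge_poly_def ac_simps)
      then show ?thesis
        using 1 E' by (intro exI[of _ "(a, b) # E'"] exI[of _ s]) simp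
    next
      case 2
      have "swap_vars i (edges_poly (e # E)) = - s * edges_poly ((b, a) # E')"
        by (simp add: swap_vars_mult sw E'(2)) (simp add: edge_poly_def algebra_simps)
      then show ?thesis
        using 2 E' by (intro exI[of _ "(b, a) # E'"] exI[of _ "- s"]) simp
    qed
  qed
  then show ?thesis
    using that by blast
qed

text \<open>A list permits repeated factors. One choice of \<open>E\<close> for all N lets a single
  partition function treat the whole family.\<close>

definition cleared :: "(nat \<Rightarrow> mpol) \<Rightarrow> bool" where
  "cleared f \<longleftrightarrow> (\<exists>E. (\<forall>e\<in>set E. fst e < snd e) \<and> affine_family (\<lambda>N. edges_poly E * f N))"

text \<open>If D clears f and D' is its exchanged version, then (x_i - x_(i+1)) D D' clears the
  Demazure image: both terms of the numerator become fixed multiples of D f and of its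
  exchange.\<close>

lemma cleared_demazure:
  assumes "cleared f"
  shows "cleared (\<lambda>N. demazure i (f N))"
proof -
  obtain E where E: "\<forall>e\<in>set E. fst e < snd e" and f: "affine_family (\<lambda>N. edges_poly E * f N)"
    using assms by (auto simp: cleared_def)
  obtain E' s where E': "\<forall>e\<in>set E'. fst e < snd e"
    and sE: "swap_vars i (edges_poly E) = s * edges_poly E'" and s: "s * s = 1"
    using swap_vars_edges_poly[OF E] by metis
  let ?D = "edges_poly E" and ?D' = "edges_poly E'"
  have "?D' * swap_vars i g = s * swap_vars i (?D * g)" for g
  proof -
    have "s * swap_vars i (?D * g) = (s * s) * (?D' * swap_vars i g)"
      by (simp only: swap_vars_mult sE ac_simps)
    then show ?thesis
      by (simp add: s)
  qed
  then have "edges_poly ((i, Suc i) # E @ E') * demazure i g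
      = (xvar i * ?D') * (?D * g) - (xvar (Suc i) * ?D * s) * swap_vars i (?D * g)" for g
  proof -
    assume swap: "\<And>g. ?D' * swap_vars i g = s * swap_vars i (?D * g)"
    have "edges_poly ((i, Suc i) # E @ E') * demazure i g
        = (?D * ?D') * ((xvar i - xvar (Suc i)) * demazure i g)"
      by (simp add: edge_poly_def ac_simps)
    also have "\<dots> = (xvar i * ?D') * (?D * g) - (xvar (Suc i) * ?D) * (?D' * swap_vars i g)"
      unfolding demazure_mult by (simp add: right_diff_distrib ac_simps)
    finally show ?thesis
      unfolding swap by (simp only: ac_simps)
  qed
  then have "affine_family (\<lambda>N. edges_poly ((i, Suc i) # E @ E') * demazure i (f N))"
    by (simp only:) (intro affine_family.diff affine_family_mult affine_family_swap_vars f)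
  then show ?thesis
    unfolding cleared_def using E E' by (intro exI[of _ "(i, Suc i) # E @ E'"]) auto
qed

section \<open>Key polynomials of compositions affine in N\<close>

lemma ivec_of_nth_affine:
  assumes "\<forall>\<^sub>F N in sequentially. length (c N) = h \<and> (\<forall>j<h. int (c N ! j) = int N * p j + q j)"
  shows "\<exists>u v. \<forall>\<^sub>F N in sequentially. ivec_of (Poly_Mapping.nth (c N)) = frag_cmul (int N) u + v"
proof -
  let ?vec = "\<lambda>p. \<Sum>j<h. frag_cmul (p j) (frag_of j)"
  have vec: "Poly_Mapping.lookup (?vec p) j = (if j < h then p j else 0)" for p j
  proof -
    have "Poly_Mapping.lookup (?vec p) j = (\<Sum>k<h. if k = j then p k else 0)"
      unfolding lookup_sum by (intro sum.cong) auto
    then show ?thesis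
      by simp
  qed
  have "\<forall>\<^sub>F N in sequentially. ivec_of (Poly_Mapping.nth (c N)) = frag_cmul (int N) (?vec p) + ?vec q"
    using assms
  proof eventually_elim
    case (elim N)
    then show ?case
      by (intro poly_mapping_eqI) (simp add: lookup_add vec nth_default_def)
  qed
  then show ?thesis
    by blast
qed

text \<open>The entries compare in the same way for all N from \<open>N0\<close> on, so an ascent at
  \<open>N0\<close> is an ascent throughout and the same Demazure operator applies to the whole
  family. The weight at \<open>N0\<close> decreases; \<open>p\<close> and \<open>q\<close> are
  general because they get permuted.\<close>

lemma cleared_key_poly:
  fixes c :: "nat \<Rightarrow> nat list"
  assumes "\<And>N. N \<ge> N0 \<Longrightarrow> length (c N) = h"
    and "\<And>N j. N \<ge> N0 \<Longrightarrow> j < h \<Longrightarrow> int (c N ! j) = int N * p j + q j"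
    and "\<And>N j k. N \<ge> N0 \<Longrightarrow> j < h \<Longrightarrow> k < h \<Longrightarrow> c N ! j < c N ! k \<longleftrightarrow> c N0 ! j < c N0 ! k"
  shows "cleared (\<lambda>N. key_poly (c N))"
  using assms
proof (induction "weight (c N0)" arbitrary: c p q rule: less_induct)
  case less
  note len = less.prems(1) and aff = less.prems(2) and cmp = less.prems(3)
  show ?case
  proof (cases "sorted_wrt (\<ge>) (c N0)")
    case True
    have "sorted_wrt (\<ge>) (c N)" if "N \<ge> N0" for N
      using True len[OF that] len[of N0] cmp[OF that] Suc_lessD unfolding decreasing_or_ascent by auto
    then have eq: "\<forall>\<^sub>F N in sequentially. key_poly (c N) = frag_of (Poly_Mapping.nth (c N))"
      unfolding eventually_sequentially by (metis key_poly_decreasing xmonom_def)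
    have "\<forall>\<^sub>F N in sequentially. length (c N) = h \<and> (\<forall>j<h. int (c N ! j) = int N * p j + q j)"
      unfolding eventually_sequentially using len aff by blast
    then obtain u v where
      "\<forall>\<^sub>F N in sequentially. ivec_of (Poly_Mapping.nth (c N)) = frag_cmul (int N) u + v"
      using ivec_of_nth_affine by blast
    then have "affine_family (\<lambda>N. frag_of (Poly_Mapping.nth (c N)))"
      by (rule affine_family.monom)
    from affine_family.cong[OF this eq] show ?thesis
      unfolding cleared_def by (intro exI[of _ "[]"]) simp
  next
    case False
    then obtain i where "Suc i < length (c N0)" and asc0: "c N0 ! i < c N0 ! Suc i"
      using decreasing_or_ascent by blast
    then have i: "Suc i < h"
      using len[of N0] by simp
    have tr: "tr i j < h" if "j < h" for j
      using i that by (auto simp: Transposition.transpose_def)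
    have "cleared (\<lambda>N. key_poly (swap_parts i (c N)))"
    proof (rule less.hyps)
      show "weight (swap_parts i (c N0)) < weight (c N0)"
        using i asc0 len[of N0] by (intro weight_swap_parts) auto
      show "length (swap_parts i (c N)) = h" if "N \<ge> N0" for N
        using len that by simp
      show "int (swap_parts i (c N) ! j) = int N * p (tr i j) + q (tr i j)" if "N \<ge> N0" "j < h" for N j
        using len aff tr that i by (simp add: nth_swap_parts)
      show "swap_parts i (c N) ! j < swap_parts i (c N) ! k
          \<longleftrightarrow> swap_parts i (c N0) ! j < swap_parts i (c N0) ! k"
        if "N \<ge> N0" "j < h" "k < h" for N j k
        using len cmp[of N "tr i j" "tr i k"] tr that i by (simp add: nth_swap_parts)
    qed
    from cleared_demazure[OF this] obtain E where E: "\<forall>e\<in>set E. fst e < snd e"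
      "affine_family (\<lambda>N. edges_poly E * demazure i (key_poly (swap_parts i (c N))))"
      unfolding cleared_def by blast
    have "key_poly (c N) = demazure i (key_poly (swap_parts i (c N)))" if "N \<ge> N0" for N
      using len[OF that] cmp[OF that, of i "Suc i"] i asc0 by (intro key_poly_ascent) auto
    then have "\<forall>\<^sub>F N in sequentially.
        edges_poly E * key_poly (c N) = edges_poly E * demazure i (key_poly (swap_parts i (c N)))"
      unfolding eventually_sequentially by metis
    from affine_family.cong[OF E(2) this] show ?thesis
      unfolding cleared_def using E(1) by blast
  qed
qed

text \<open>Convolution with the partition function of the cleared factors recovers the original
  coefficients.\<close>

lemma evpoly_lookup_cleared:
  assumes "cleared f" "\<forall>\<^sub>F N in sequentially. ivec_of (m N) = frag_cmul (int N) u + v"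
  shows "evpoly (\<lambda>N. Poly_Mapping.lookup (f N) (m N))"
proof -
  obtain E where E: "\<forall>e\<in>set E. fst e < snd e" and f: "affine_family (\<lambda>N. edges_poly E * f N)"
    using assms(1) by (auto simp: cleared_def)
  \<comment> \<open>Indexing by positions keeps repeated edges as separate roots.\<close>
  define I where "I = {..<length E}"
  define K where "K = partition_fun I (\<lambda>k. root (E ! k))"
  define s where "s = (\<Sum>k\<in>I. frag_of (fst (E ! k)))"
  have I: "finite I" "\<And>k. k \<in> I \<Longrightarrow> fst (E ! k) < snd (E ! k)"
    using E by (auto simp: I_def)
  have "edges_poly E = (\<Prod>k\<in>I. edge_poly (E ! k))"
    by (simp add: edges_poly_def I_def prod.list_conv_set_nth atLeast0LessThan)
  then have coeff: "Poly_Mapping.lookup (f N) (m N) = conv K (edges_poly E * f N) (ivec_of (m N) + s)" for N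
    using conv_partition_fun_edge_polys[OF I] by (simp add: K_def s_def conv_delta)
  have "evpoly (\<lambda>N. conv K (edges_poly E * f N) (frag_cmul (int N) u + (v + s)))"
    unfolding K_def by (intro evpoly_conv_affine_family[OF f] evpoly_partition_fun I)
  moreover have "\<forall>\<^sub>F N in sequentially. Poly_Mapping.lookup (f N) (m N)
      = conv K (edges_poly E * f N) (frag_cmul (int N) u + (v + s))"
    using assms(2) by eventually_elim (simp add: coeff ac_simps)
  ultimately show ?thesis
    by (rule evpoly_cong)
qed

text \<open>Different slopes decide the comparison once N exceeds the distance of the constant
  terms; equal slopes leave the constant terms to decide.\<close>

lemma eventually_affine_less_stable:
  fixes p q p' q' :: int
  shows "\<exists>b. \<forall>\<^sub>F N in sequentially. (int N * p + q < int N * p' + q') \<longleftrightarrow> b"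
proof -
  consider "p = p'" | "p < p'" | "p' < p"
    by linarith
  then show ?thesis
  proof cases
    case 1
    then show ?thesis
      by (intro exI[of _ "q < q'"]) simp
  next
    case 2
    have "int N * p + q < int N * p' + q'" if N: "N \<ge> Suc (nat \<bar>q - q'\<bar>)" for N
    proof -
      have "int N * 1 \<le> int N * (p' - p)"
        using 2 by (intro mult_left_mono) auto
      then show ?thesis
        using N by (simp add: right_diff_distrib)
    qed
    then show ?thesis
      unfolding eventually_sequentially by blast
  next
    case 3
    have "\<not> int N * p + q < int N * p' + q'" if N: "N \<ge> Suc (nat \<bar>q - q'\<bar>)" for N
    proof -
      have "int N * 1 \<le> int N * (p - p')"
        using 3 by (intro mult_left_mono) auto
      then show ?thesis
        using N by (simp add: right_diff_distrib)
    qed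
    then show ?thesis
      unfolding eventually_sequentially by blast
  qed
qed

theorem theorem3p1:
  fixes h :: nat and \<alpha> \<nu> :: "nat list" and \<beta> \<eta> :: "int list"
  assumes "length \<alpha> = h" "length \<nu> = h" "length \<beta> = h" "length \<eta> = h"
    and "\<forall>\<^sub>F N in sequentially.
           (\<forall>p\<in>set (dilate N \<alpha> \<beta>). 0 \<le> p) \<and> (\<forall>p\<in>set (dilate N \<nu> \<eta>). 0 \<le> p)
           \<and> sum_list (dilate N \<alpha> \<beta>) = sum_list (dilate N \<nu> \<eta>)"
  shows "\<exists>P :: rat poly. \<forall>\<^sub>F N in sequentially.
           of_int (xcoeff (map nat (dilate N \<nu> \<eta>)) (key_poly (map nat (dilate N \<alpha> \<beta>))))
             = poly P (of_nat N)"
proof -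
  let ?p = "\<lambda>j. int (\<alpha> ! j)" and ?q = "\<lambda>j. \<beta> ! j"
  let ?c = "\<lambda>N. map nat (dilate N \<alpha> \<beta>)" and ?m = "\<lambda>N. map nat (dilate N \<nu> \<eta>)"
  have nth_nat_dilate: "int (map nat (dilate N a b) ! j) = int N * int (a ! j) + b ! j"
    if "length a = h" "length b = h" "\<forall>p\<in>set (dilate N a b). 0 \<le> p" "j < h" for N a b j
  proof -
    have "j < length (dilate N a b)"
      using that by (simp add: dilate_def)
    then have "0 \<le> dilate N a b ! j" "map nat (dilate N a b) ! j = nat (dilate N a b ! j)"
      using that(3) by (auto simp: nth_mem)
    then show ?thesis
      using that by (simp add: dilate_def)
  qed
  \<comment> \<open>The eventual truth value of each comparison of entries. There are finitely many
    pairs, so one threshold \<open>N1\<close> serves them all.\<close>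
  define b where "b j k =
    (SOME b. \<forall>\<^sub>F N in sequentially. (int N * ?p j + ?q j < int N * ?p k + ?q k) \<longleftrightarrow> b)" for j k
  have b: "\<forall>\<^sub>F N in sequentially. (int N * ?p j + ?q j < int N * ?p k + ?q k) \<longleftrightarrow> b j k" for j k
    unfolding b_def by (rule someI_ex) (rule eventually_affine_less_stable)
  have "\<forall>\<^sub>F N in sequentially. \<forall>j\<in>{..<h}. \<forall>k\<in>{..<h}.
      (int N * ?p j + ?q j < int N * ?p k + ?q k) \<longleftrightarrow> b j k"
    by (intro eventually_ball_finite ballI b) auto
  then obtain N1 where N1: "\<forall>N\<ge>N1. \<forall>j\<in>{..<h}. \<forall>k\<in>{..<h}.
      (int N * ?p j + ?q j < int N * ?p k + ?q k) \<longleftrightarrow> b j k"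
    unfolding eventually_sequentially ..
  obtain N2 where N2: "\<forall>N\<ge>N2. (\<forall>p\<in>set (dilate N \<alpha> \<beta>). 0 \<le> p) \<and> (\<forall>p\<in>set (dilate N \<nu> \<eta>). 0 \<le> p)
      \<and> sum_list (dilate N \<alpha> \<beta>) = sum_list (dilate N \<nu> \<eta>)"
    using assms(5) unfolding eventually_sequentially ..
  define N0 where "N0 = max N1 N2"
  have nonneg: "\<forall>p\<in>set (dilate N \<alpha> \<beta>). 0 \<le> p" if "N \<ge> N0" for N
  proof -
    have "N \<ge> N2"
      using that by (simp add: N0_def)
    then show ?thesis
      using N2 by blast
  qed
  have cmp: "(int N * ?p j + ?q j < int N * ?p k + ?q k) \<longleftrightarrow> b j k"
    if "N \<ge> N0" "j < h" "k < h" for N j k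
  proof -
    have "N \<ge> N1"
      using that by (simp add: N0_def)
    then show ?thesis
      using N1 that by blast
  qed
  have aff: "int (?c N ! j) = int N * ?p j + ?q j" if "N \<ge> N0" "j < h" for N j
    using nth_nat_dilate[OF assms(1,3) nonneg] that by blast
  have "cleared (\<lambda>N. key_poly (?c N))"
  proof (rule cleared_key_poly[where p = ?p and q = ?q])
    show "length (?c N) = h" for N
      using assms by (simp add: dilate_def)
    show "int (?c N ! j) = int N * ?p j + ?q j" if "N \<ge> N0" "j < h" for N j
      using aff that .
    have "?c N ! j < ?c N ! k \<longleftrightarrow> b j k" if "N \<ge> N0" "j < h" "k < h" for N j k
      using cmp[OF that] aff that by (metis of_nat_less_iff)
    then show "?c N ! j < ?c N ! k \<longleftrightarrow> ?c N0 ! j < ?c N0 ! k" if "N \<ge> N0" "j < h" "k < h" for N j k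
      using that by blast
  qed
  moreover have "\<forall>\<^sub>F N in sequentially.
      length (?m N) = h \<and> (\<forall>j<h. int (?m N ! j) = int N * int (\<nu> ! j) + \<eta> ! j)"
    using assms(5)
  proof eventually_elim
    case (elim N)
    then show ?case
      using nth_nat_dilate[OF assms(2,4)] assms(2,4) by (simp add: dilate_def)
  qed
  from ivec_of_nth_affine[OF this] obtain u v where
    "\<forall>\<^sub>F N in sequentially. ivec_of (Poly_Mapping.nth (?m N)) = frag_cmul (int N) u + v"
    by blast
  ultimately show ?thesis
    unfolding xcoeff_def by (rule evpoly_lookup_cleared[unfolded evpoly_def])
qed

end
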